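(* Let $\mathcal{L}=(L,\preceq)$ be a lattice, let $X_{\mathcal{L}}$ be the set of all semi-prime filters of $\mathcal{L}$, and let $f:L\to\wp(X_{\mathcal{L}})$, $f(x)=\{F\in X_{\mathcal{L}}: x\in F\}$, be the Stone map of $\mathcal{L}$. Then $f$ is an isomorphism of $(L,\preceq)$ onto $(f(L),\subseteq)$. Moreover $(f(L),\subseteq)$ is a lattice of sets closed under finite intersections, $f(L)$ separates $X_{\mathcal{L}}$, and for every $a,b\in L$ we have $$f(a)\wedge f(b)=f(a\wedge b)=f(a)\cap f(b),$$ $$f(a)\vee f(b)=f(a\vee b)=\bigcup\{f(x): x\in\bar{\mathbf{I}}(a,b)\},$$ where $f(a)\wedge f(b)$ and $f(a)\vee f(b)$ are the meet and join in $(f(L),\subseteq)$.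
   Context: For $a,b\in L$, an element $x\in L$ is an internal element of $a,b$ if $x\preceq a\vee b$ and $(a\wedge x)\vee(b\wedge x)\neq x$. $\mathbf{I}(a,b)$ is the set of all internal elements of $a,b$, and $\bar{\mathbf{I}}(a,b)=\mathbf{I}(a,b)\cup\{a,b\}$. A filter of $\mathcal{L}$ is a nonempty proper subset of $L$ that is upward closed and closed under $\wedge$. A filter $F$ is semi-prime if for every $a,b\in L$ with $a\vee b\in F$ we have $\bar{\mathbf{I}}(a,b)\cap F\neq\emptyset$. $\wp(S)$ is the power set of $S$. A lattice of sets is a family of sets which is a lattice under $\subseteq$. A family $\mathcal{M}$ of subsets of $S$ separates $S$ if for all distinct $s,t\in S$ there is $M\in\mathcal{M}$ containing exactly one of $s,t$. *)

theory Defs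
  imports "HOL-Algebra.Lattice"
begin

definition internals :: "('a, 'b) gorder_scheme \<Rightarrow> 'a \<Rightarrow> 'a \<Rightarrow> 'a set" where
  "internals L a b =
     {x \<in> carrier L. x \<sqsubseteq>\<^bsub>L\<^esub> a \<squnion>\<^bsub>L\<^esub> b \<and> (a \<sqinter>\<^bsub>L\<^esub> x) \<squnion>\<^bsub>L\<^esub> (b \<sqinter>\<^bsub>L\<^esub> x) \<noteq> x}"

definition internals_bar :: "('a, 'b) gorder_scheme \<Rightarrow> 'a \<Rightarrow> 'a \<Rightarrow> 'a set" where
  "internals_bar L a b = internals L a b \<union> {a, b}"

definition lattice_filter :: "('a, 'b) gorder_scheme \<Rightarrow> 'a set \<Rightarrow> bool" where
  "lattice_filter L F \<longleftrightarrow>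
     F \<noteq> {} \<and> F \<subset> carrier L \<and>
     (\<forall>x\<in>F. \<forall>y\<in>carrier L. x \<sqsubseteq>\<^bsub>L\<^esub> y \<longrightarrow> y \<in> F) \<and>
     (\<forall>x\<in>F. \<forall>y\<in>F. x \<sqinter>\<^bsub>L\<^esub> y \<in> F)"

definition semi_prime_filter :: "('a, 'b) gorder_scheme \<Rightarrow> 'a set \<Rightarrow> bool" where
  "semi_prime_filter L F \<longleftrightarrow>
     lattice_filter L F \<and>
     (\<forall>a\<in>carrier L. \<forall>b\<in>carrier L.
        a \<squnion>\<^bsub>L\<^esub> b \<in> F \<longrightarrow> internals_bar L a b \<inter> F \<noteq> {})"

definition semi_prime_filters :: "('a, 'b) gorder_scheme \<Rightarrow> 'a set set" where
  "semi_prime_filters L = {F. semi_prime_filter L F}"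

definition stone_map :: "('a, 'b) gorder_scheme \<Rightarrow> 'a \<Rightarrow> 'a set set" where
  "stone_map L x = {F \<in> semi_prime_filters L. x \<in> F}"

definition inclusion_order :: "'s set set \<Rightarrow> 's set gorder" where
  "inclusion_order \<M> = \<lparr>carrier = \<M>, eq = (=), le = (\<subseteq>)\<rparr>"

definition order_isomorphism ::
    "('a, 'c) gorder_scheme \<Rightarrow> ('b, 'd) gorder_scheme \<Rightarrow> ('a \<Rightarrow> 'b) \<Rightarrow> bool" where
  "order_isomorphism A B f \<longleftrightarrow> order_emb A B f \<and> bij_betw f (carrier A) (carrier B)"

text \<open>Join and meet in a lattice of sets are those of the inclusion order restricted to the
  family; they need not be union and intersection.\<close>

definition lattice_of_sets :: "'s set set \<Rightarrow> bool" where
  "lattice_of_sets \<M> \<longleftrightarrow> lattice (inclusion_order \<M>)"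

text \<open>Only nonempty intersections are meant: the empty one would be the whole ground set, which
  the image of the Stone map of a lattice without a greatest element need not contain.\<close>

definition finite_inter_closed :: "'s set set \<Rightarrow> bool" where
  "finite_inter_closed \<M> \<longleftrightarrow>
     (\<forall>\<A>. \<A> \<subseteq> \<M> \<and> finite \<A> \<and> \<A> \<noteq> {} \<longrightarrow> \<Inter>\<A> \<in> \<M>)"

definition separates :: "'s set set \<Rightarrow> 's set \<Rightarrow> bool" where
  "separates \<M> S \<longleftrightarrow>
     \<M> \<subseteq> Pow S \<and>
     (\<forall>s\<in>S. \<forall>t\<in>S. s \<noteq> t \<longrightarrow> (\<exists>M\<in>\<M>. (s \<in> M) \<noteq> (t \<in> M)))"

end

theory Submission
  imports Defs
begin

text \<open>
  The heart of the matter is that semi-prime filters are plentiful: whenever \<open>a\<close> is not below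
  \<open>b\<close>, some semi-prime filter contains \<open>a\<close> and avoids \<open>b\<close>
  (\<open>semi_prime_filter_between\<close>). Zorn's lemma, started at the principal filter of \<open>a\<close>, gives a
  filter \<open>F\<close> that is maximal among the filters avoiding \<open>b\<close>, and every such \<open>F\<close> is semi-prime
  (\<open>maximal_avoiding_filter_semi_prime\<close>). In a distributive lattice the same \<open>F\<close> would
  be prime, by distributing a meet over a join. Here distributivity may fail, but the internal
  elements of \<open>x\<close>, \<open>y\<close> are precisely the elements \<open>h\<close> below \<open>x \<squnion> y\<close> for which
  \<open>(x \<sqinter> h) \<squnion> (y \<sqinter> h)\<close> differs from \<open>h\<close>. So if \<open>F\<close> contains none of them, the instance of
  distributivity needed in the classical argument is available for every \<open>h \<in> F\<close> below
  \<open>x \<squnion> y\<close>.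

  Everything else is formal. By this abundance, the Stone map reflects the order, hence embeds the
  lattice into the inclusion order; meets and joins in the image are then the images of meets
  and joins. Closure of filters under meets turns meets into intersections. One inclusion of the
  formula for joins is the definition of semi-primeness; the other holds because internal elements
  lie below the join.
\<close>

section \<open>Abundance of semi-prime filters\<close>

lemma lattice_filterI:
  fixes L (structure)
  assumes "F \<noteq> {}" "F \<subset> carrier L"
    and "\<And>x y. x \<in> F \<Longrightarrow> y \<in> carrier L \<Longrightarrow> x \<sqsubseteq> y \<Longrightarrow> y \<in> F"
    and "\<And>x y. x \<in> F \<Longrightarrow> y \<in> F \<Longrightarrow> x \<sqinter> y \<in> F"
  shows "lattice_filter L F"
  using assms unfolding lattice_filter_def by blast

lemma lattice_filterD:
  fixes L (structure)
  assumes "lattice_filter L F"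
  shows "F \<noteq> {}" and "F \<subseteq> carrier L"
    and "\<And>x y. x \<in> F \<Longrightarrow> y \<in> carrier L \<Longrightarrow> x \<sqsubseteq> y \<Longrightarrow> y \<in> F"
    and "\<And>x y. x \<in> F \<Longrightarrow> y \<in> F \<Longrightarrow> x \<sqinter> y \<in> F"
  using assms unfolding lattice_filter_def by blast+

lemma (in lattice) meet_mono:
  assumes "x \<sqsubseteq> x'" "y \<sqsubseteq> y'"
    and "x \<in> carrier L" "x' \<in> carrier L" "y \<in> carrier L" "y' \<in> carrier L"
  shows "x \<sqinter> y \<sqsubseteq> x' \<sqinter> y'"
  using assms by (meson le_trans meet_closed meet_le meet_left meet_right)

lemma (in lattice) principal_filter:
  assumes "a \<in> carrier L" "b \<in> carrier L" "\<not> a \<sqsubseteq> b"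
  shows "lattice_filter L {z \<in> carrier L. a \<sqsubseteq> z}"
proof (rule lattice_filterI)
  show "{z \<in> carrier L. a \<sqsubseteq> z} \<noteq> {}" using assms by blast
  show "{z \<in> carrier L. a \<sqsubseteq> z} \<subset> carrier L" using assms by blast
  show "y \<in> {z \<in> carrier L. a \<sqsubseteq> z}"
    if "x \<in> {z \<in> carrier L. a \<sqsubseteq> z}" "y \<in> carrier L" "x \<sqsubseteq> y" for x y
    using that assms(1) by (blast intro: le_trans)
  show "x \<sqinter> y \<in> {z \<in> carrier L. a \<sqsubseteq> z}"
    if "x \<in> {z \<in> carrier L. a \<sqsubseteq> z}" "y \<in> {z \<in> carrier L. a \<sqsubseteq> z}" for x y
    using that assms(1) by (simp add: meet_le)
qed

text \<open>
  For a filter \<open>F\<close> and \<open>x\<close> in the carrier, this is the least upward closed and meet-closed set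
  containing \<open>F\<close> and \<open>x\<close>.
  It can be the whole lattice, so it is a filter only if something is known to lie outside it.
\<close>

definition adjoin :: "('a, 'b) gorder_scheme \<Rightarrow> 'a set \<Rightarrow> 'a \<Rightarrow> 'a set" where
  "adjoin L F x = {z \<in> carrier L. \<exists>f\<in>F. f \<sqinter>\<^bsub>L\<^esub> x \<sqsubseteq>\<^bsub>L\<^esub> z}"

lemma (in lattice)
  assumes "lattice_filter L F" "x \<in> carrier L"
  shows adjoin_extends: "F \<subseteq> adjoin L F x" and adjoin_mem: "x \<in> adjoin L F x"
proof -
  note FL = lattice_filterD(2)[OF assms(1), THEN subsetD]
  show "F \<subseteq> adjoin L F x" using FL assms(2) unfolding adjoin_def by (blast intro: meet_left)
  show "x \<in> adjoin L F x"
    using lattice_filterD(1)[OF assms(1)] FL assms(2) unfolding adjoin_def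
    by (blast intro: meet_right)
qed

lemma (in lattice) adjoin_filter:
  assumes F: "lattice_filter L F" and x: "x \<in> carrier L"
    and b: "b \<in> carrier L" "b \<notin> adjoin L F x"
  shows "lattice_filter L (adjoin L F x)"
proof (rule lattice_filterI)
  note FL = lattice_filterD(2)[OF F, THEN subsetD]
  show "adjoin L F x \<noteq> {}" using adjoin_mem[OF F x] by blast
  show "adjoin L F x \<subset> carrier L" using b by (auto simp: adjoin_def)
  show "z \<in> adjoin L F x" if y: "y \<in> adjoin L F x" and z: "z \<in> carrier L" "y \<sqsubseteq> z" for y z
    using y z FL x unfolding adjoin_def by (blast intro: le_trans meet_closed)
  show "y \<sqinter> z \<in> adjoin L F x" if y: "y \<in> adjoin L F x" and z: "z \<in> adjoin L F x" for y z
  proof -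
    obtain f g where f: "f \<in> F" "f \<sqinter> x \<sqsubseteq> y" and g: "g \<in> F" "g \<sqinter> x \<sqsubseteq> z"
      and yz: "y \<in> carrier L" "z \<in> carrier L"
      using y z by (auto simp: adjoin_def)
    have fg: "f \<sqinter> g \<in> F" using lattice_filterD(4)[OF F] f g by blast
    have "(f \<sqinter> g) \<sqinter> x \<sqsubseteq> f \<sqinter> x" "(f \<sqinter> g) \<sqinter> x \<sqsubseteq> g \<sqinter> x"
      using f g x FL by (auto intro!: meet_mono meet_left meet_right)
    then have "(f \<sqinter> g) \<sqinter> x \<sqsubseteq> y" "(f \<sqinter> g) \<sqinter> x \<sqsubseteq> z"
      using f g x FL yz by (meson le_trans meet_closed)+
    then have "(f \<sqinter> g) \<sqinter> x \<sqsubseteq> y \<sqinter> z" using FL f g x yz by (simp add: meet_le)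
    then show ?thesis using fg yz by (auto simp: adjoin_def)
  qed
qed

text \<open>
  If neither \<open>x\<close> nor \<open>y\<close> lies in \<open>F\<close>, adjoining either of them captures \<open>b\<close> by maximality, so
  some \<open>h \<in> F\<close>, which may be taken below \<open>x \<squnion> y\<close>, has \<open>x \<sqinter> h\<close> and \<open>y \<sqinter> h\<close> both below \<open>b\<close>.
  Were \<open>h\<close> not internal, it would be the join of these two meets and hence below \<open>b\<close>, forcing
  \<open>b \<in> F\<close>. So \<open>h\<close> itself is an internal element of \<open>x\<close>, \<open>y\<close> in \<open>F\<close>.
\<close>

lemma (in lattice) maximal_avoiding_filter_semi_prime:
  assumes F: "lattice_filter L F" and b: "b \<in> carrier L" "b \<notin> F"
    and max: "\<And>G. lattice_filter L G \<Longrightarrow> F \<subseteq> G \<Longrightarrow> b \<notin> G \<Longrightarrow> G = F"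
  shows "semi_prime_filter L F"
  unfolding semi_prime_filter_def
proof (intro conjI ballI impI F)
  fix x y assume x: "x \<in> carrier L" and y: "y \<in> carrier L" and xy: "x \<squnion> y \<in> F"
  note FL = lattice_filterD(2)[OF F, THEN subsetD]
  have captures: "\<exists>f\<in>F. f \<sqinter> u \<sqsubseteq> b" if u: "u \<in> carrier L" "u \<notin> F" for u
  proof -
    have "b \<in> adjoin L F u"
      using max[OF adjoin_filter[OF F u(1) b(1)] adjoin_extends[OF F u(1)]]
        adjoin_mem[OF F u(1)] u(2) by blast
    then show ?thesis by (auto simp: adjoin_def)
  qed
  show "internals_bar L x y \<inter> F \<noteq> {}"
  proof (cases "x \<in> F \<or> y \<in> F")
    case True
    then show ?thesis by (auto simp: internals_bar_def)
  next
    case False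
    then obtain f g where f: "f \<in> F" "f \<sqinter> x \<sqsubseteq> b" and g: "g \<in> F" "g \<sqinter> y \<sqsubseteq> b"
      using captures x y by blast
    note c = x y b(1) FL[OF f(1)] FL[OF g(1)] FL[OF xy]
    define h where "h = (f \<sqinter> g) \<sqinter> (x \<squnion> y)"
    have hF: "h \<in> F" unfolding h_def using lattice_filterD(4)[OF F] f g xy by blast
    note hL = FL[OF hF]
    have h_le: "h \<sqsubseteq> x \<squnion> y" "h \<sqsubseteq> f \<sqinter> g"
      unfolding h_def using c by (auto intro: meet_left meet_right)
    then have "h \<sqsubseteq> f" "h \<sqsubseteq> g"
      using c hL by (meson le_trans meet_closed meet_left meet_right)+
    then have "h \<sqinter> x \<sqsubseteq> f \<sqinter> x" "h \<sqinter> y \<sqsubseteq> g \<sqinter> y"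
      using c hL by (auto intro!: meet_mono)
    then have "x \<sqinter> h \<sqsubseteq> b" "y \<sqinter> h \<sqsubseteq> b"
      using f(2) g(2) c hL by (metis le_trans meet_closed meet_comm)+
    then have "(x \<sqinter> h) \<squnion> (y \<sqinter> h) \<sqsubseteq> b" using c hL by (simp add: join_le)
    then have "(x \<sqinter> h) \<squnion> (y \<sqinter> h) \<noteq> h" using lattice_filterD(3)[OF F hF b(1)] b(2) by auto
    then have "h \<in> internals L x y" using hL h_le by (simp add: internals_def)
    then show ?thesis using hF by (auto simp: internals_bar_def)
  qed
qed

text \<open>
  A union of proper sets can exhaust the carrier; a common element \<open>b\<close> avoided along the chain
  keeps it proper.
\<close>

lemma (in lattice) Union_chain_filter:
  assumes ne: "C \<noteq> {}" and filters: "\<And>F. F \<in> C \<Longrightarrow> lattice_filter L F"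
    and chain: "\<And>F G. F \<in> C \<Longrightarrow> G \<in> C \<Longrightarrow> F \<subseteq> G \<or> G \<subseteq> F"
    and b: "b \<in> carrier L" "b \<notin> \<Union>C"
  shows "lattice_filter L (\<Union>C)"
proof (rule lattice_filterI)
  show "\<Union>C \<noteq> {}" using ne filters lattice_filterD(1) by blast
  show "\<Union>C \<subset> carrier L" using filters lattice_filterD(2) b by blast
  show "y \<in> \<Union>C" if "x \<in> \<Union>C" "y \<in> carrier L" "x \<sqsubseteq> y" for x y
    using that filters lattice_filterD(3) by (metis UnionE UnionI)
  show "x \<sqinter> y \<in> \<Union>C" if xy: "x \<in> \<Union>C" "y \<in> \<Union>C" for x y
  proof -
    obtain F where F: "F \<in> C" "x \<in> F" "y \<in> F" using xy chain by (meson UnionE subsetD)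
    show ?thesis by (rule UnionI[OF F(1) lattice_filterD(4)[OF filters[OF F(1)] F(2,3)]])
  qed
qed

lemma (in lattice) semi_prime_filter_between:
  assumes a: "a \<in> carrier L" and b: "b \<in> carrier L" and ab: "\<not> a \<sqsubseteq> b"
  obtains F where "semi_prime_filter L F" "a \<in> F" "b \<notin> F"
proof -
  let ?A = "{F. lattice_filter L F \<and> a \<in> F \<and> b \<notin> F}"
  have "\<exists>M\<in>?A. \<forall>X\<in>?A. M \<subseteq> X \<longrightarrow> X = M"
  proof (rule subset_Zorn_nonempty)
    show "?A \<noteq> {}" using principal_filter[OF a b ab] a ab by blast
    show "\<Union>C \<in> ?A" if ne: "C \<noteq> {}" and C: "subset.chain ?A C" for C
    proof -
      have sub: "C \<subseteq> ?A" and "\<And>F G. F \<in> C \<Longrightarrow> G \<in> C \<Longrightarrow> F \<subseteq> G \<or> G \<subseteq> F"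
        using C by (auto simp: subset_chain_def)
      then have "lattice_filter L (\<Union>C)"
        using ne b by (intro Union_chain_filter[where b = b]) auto
      then show ?thesis using sub ne by blast
    qed
  qed
  then obtain M where M: "lattice_filter L M" "a \<in> M" "b \<notin> M"
    and max: "\<And>X. lattice_filter L X \<Longrightarrow> a \<in> X \<Longrightarrow> b \<notin> X \<Longrightarrow> M \<subseteq> X \<Longrightarrow> X = M"
    by blast
  have "semi_prime_filter L M"
    by (rule maximal_avoiding_filter_semi_prime[OF M(1) b M(3)]) (use max M(2) in blast)
  then show thesis using that M by blast
qed

section \<open>The Stone map\<close>

lemma (in lattice) stone_map_subset_iff:
  assumes "a \<in> carrier L" "b \<in> carrier L"
  shows "stone_map L a \<subseteq> stone_map L b \<longleftrightarrow> a \<sqsubseteq> b"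
proof
  show "stone_map L a \<subseteq> stone_map L b" if "a \<sqsubseteq> b"
    using that assms lattice_filterD(3)
    by (fastforce simp: stone_map_def semi_prime_filters_def semi_prime_filter_def)
  show "a \<sqsubseteq> b" if "stone_map L a \<subseteq> stone_map L b"
  proof (rule ccontr)
    assume "\<not> a \<sqsubseteq> b"
    then obtain F where "semi_prime_filter L F" "a \<in> F" "b \<notin> F"
      using semi_prime_filter_between assms by blast
    then show False using that by (auto simp: stone_map_def semi_prime_filters_def)
  qed
qed

lemma (in lattice) stone_map_meet:
  assumes "a \<in> carrier L" "b \<in> carrier L"
  shows "stone_map L (a \<sqinter> b) = stone_map L a \<inter> stone_map L b"
proof
  show "stone_map L (a \<sqinter> b) \<subseteq> stone_map L a \<inter> stone_map L b"
    using assms by (simp add: stone_map_subset_iff meet_left meet_right)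
  show "stone_map L a \<inter> stone_map L b \<subseteq> stone_map L (a \<sqinter> b)"
    using lattice_filterD(4)
    by (fastforce simp: stone_map_def semi_prime_filters_def semi_prime_filter_def)
qed

lemma (in lattice) internals_bar_le_join:
  assumes "a \<in> carrier L" "b \<in> carrier L" "x \<in> internals_bar L a b"
  shows "x \<in> carrier L" "x \<sqsubseteq> a \<squnion> b"
  using assms by (auto simp: internals_bar_def internals_def join_left join_right)

lemma (in lattice) stone_map_join:
  assumes "a \<in> carrier L" "b \<in> carrier L"
  shows "stone_map L (a \<squnion> b) = (\<Union>x\<in>internals_bar L a b. stone_map L x)"
proof
  show "stone_map L (a \<squnion> b) \<subseteq> (\<Union>x\<in>internals_bar L a b. stone_map L x)"
    using assms by (fastforce simp: stone_map_def semi_prime_filters_def semi_prime_filter_def)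
  show "(\<Union>x\<in>internals_bar L a b. stone_map L x) \<subseteq> stone_map L (a \<squnion> b)"
    using assms internals_bar_le_join[OF assms] by (intro UN_least) (simp add: stone_map_subset_iff)
qed

text \<open>
  The members of the image containing a filter are named by its own elements, so the image tells
  any two different filters apart.
\<close>

lemma stone_map_separates:
  "separates (stone_map L ` carrier L) (semi_prime_filters L)"
  unfolding separates_def
proof (intro conjI ballI impI)
  show "stone_map L ` carrier L \<subseteq> Pow (semi_prime_filters L)" by (auto simp: stone_map_def)
next
  fix F G assume FG: "F \<in> semi_prime_filters L" "G \<in> semi_prime_filters L" "F \<noteq> G"
  then have "F \<subseteq> carrier L" "G \<subseteq> carrier L"
    using lattice_filterD(2) by (auto simp: semi_prime_filters_def semi_prime_filter_def)
  then obtain x where "x \<in> carrier L" "(x \<in> F) \<noteq> (x \<in> G)" using FG(3) by blast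
  then show "\<exists>M\<in>stone_map L ` carrier L. (F \<in> M) \<noteq> (G \<in> M)"
    using FG(1,2) by (auto simp: stone_map_def)
qed

section \<open>Order embeddings into inclusion orders\<close>

lemma inclusion_order_simps [simp]:
  "carrier (inclusion_order M) = M"
  "le (inclusion_order M) = (\<subseteq>)"
  "eq (inclusion_order M) = (=)"
  by (simp_all add: inclusion_order_def)

lemma inclusion_order_partial_order: "partial_order (inclusion_order M)"
  by unfold_locales auto

context lattice
begin

context
  fixes f :: "'a \<Rightarrow> 's set"
  assumes emb: "\<And>x y. x \<in> carrier L \<Longrightarrow> y \<in> carrier L \<Longrightarrow> f x \<subseteq> f y \<longleftrightarrow> x \<sqsubseteq> y"
begin

lemma embedding_isomorphism:
  "order_isomorphism L (inclusion_order (f ` carrier L)) f"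
proof -
  have "inj_on f (carrier L)"
  proof (rule inj_onI)
    fix x y assume xy: "x \<in> carrier L" "y \<in> carrier L" "f x = f y"
    then have "x \<sqsubseteq> y" "y \<sqsubseteq> x" using emb[of x y] emb[of y x] by auto
    then show "x = y" using xy by (simp add: le_antisym)
  qed
  moreover have "weak_partial_order (inclusion_order (f ` carrier L))"
    by (rule partial_order.axioms(1)[OF inclusion_order_partial_order])
  ultimately show ?thesis
    using weak_partial_order_axioms emb
    by (simp add: order_isomorphism_def order_emb_def bij_betw_def)
qed

text \<open>
  Bounds are sought inside the image only: a bound there is some \<open>f c\<close>, and order reflection turns
  it into a bound \<open>c\<close> in \<open>L\<close>. This is why \<open>f (a \<squnion> b)\<close> is least although it may be larger
  than the union of \<open>f a\<close> and \<open>f b\<close>.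
\<close>

lemma embedding_least:
  assumes "a \<in> carrier L" "b \<in> carrier L"
  shows "least (inclusion_order (f ` carrier L)) (f (a \<squnion> b))
           (Upper (inclusion_order (f ` carrier L)) {f a, f b})"
proof (rule least_UpperI)
  show "z \<sqsubseteq>\<^bsub>inclusion_order (f ` carrier L)\<^esub> f (a \<squnion> b)" if "z \<in> {f a, f b}" for z
    using that assms by (elim insertE emptyE) (simp_all add: emb join_left join_right)
  show "f (a \<squnion> b) \<sqsubseteq>\<^bsub>inclusion_order (f ` carrier L)\<^esub> S"
    if S: "S \<in> Upper (inclusion_order (f ` carrier L)) {f a, f b}" for S
  proof -
    obtain c where c: "c \<in> carrier L" "S = f c" "f a \<subseteq> f c" "f b \<subseteq> f c"
      using S assms by (auto simp: Upper_def)
    then have "a \<squnion> b \<sqsubseteq> c" using assms emb by (simp add: join_le)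
    then show ?thesis using c assms by (simp add: emb)
  qed
qed (use assms in simp_all)

lemma embedding_greatest:
  assumes "a \<in> carrier L" "b \<in> carrier L"
  shows "greatest (inclusion_order (f ` carrier L)) (f (a \<sqinter> b))
           (Lower (inclusion_order (f ` carrier L)) {f a, f b})"
proof (rule greatest_LowerI)
  show "f (a \<sqinter> b) \<sqsubseteq>\<^bsub>inclusion_order (f ` carrier L)\<^esub> z" if "z \<in> {f a, f b}" for z
    using that assms by (elim insertE emptyE) (simp_all add: emb meet_left meet_right)
  show "S \<sqsubseteq>\<^bsub>inclusion_order (f ` carrier L)\<^esub> f (a \<sqinter> b)"
    if S: "S \<in> Lower (inclusion_order (f ` carrier L)) {f a, f b}" for S
  proof -
    obtain c where c: "c \<in> carrier L" "S = f c" "f c \<subseteq> f a" "f c \<subseteq> f b"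
      using S assms by (auto simp: Lower_def)
    then have "c \<sqsubseteq> a \<sqinter> b" using assms emb by (simp add: meet_le)
    then show ?thesis using c assms by (simp add: emb)
  qed
qed (use assms in simp_all)

lemma embedding_lattice_of_sets: "lattice_of_sets (f ` carrier L)"
proof -
  interpret I: partial_order "inclusion_order (f ` carrier L)"
    by (rule inclusion_order_partial_order)
  show ?thesis
    unfolding lattice_of_sets_def
  proof unfold_locales
    fix S T
    assume "S \<in> carrier (inclusion_order (f ` carrier L))"
      and "T \<in> carrier (inclusion_order (f ` carrier L))"
    then obtain a b where ab: "a \<in> carrier L" "b \<in> carrier L" and ST: "S = f a" "T = f b"
      by auto
    show "\<exists>s. least (inclusion_order (f ` carrier L)) s
                (Upper (inclusion_order (f ` carrier L)) {S, T})"
      unfolding ST by (rule exI, rule embedding_least[OF ab])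
    show "\<exists>s. greatest (inclusion_order (f ` carrier L)) s
                (Lower (inclusion_order (f ` carrier L)) {S, T})"
      unfolding ST by (rule exI, rule embedding_greatest[OF ab])
  qed
qed

lemma embedding_join:
  assumes "a \<in> carrier L" "b \<in> carrier L"
  shows "f a \<squnion>\<^bsub>inclusion_order (f ` carrier L)\<^esub> f b = f (a \<squnion> b)"
proof -
  interpret I: partial_order "inclusion_order (f ` carrier L)"
    by (rule inclusion_order_partial_order)
  show ?thesis
    unfolding join_def[of "inclusion_order _"] sup_def[of "inclusion_order _"]
    by (rule some_equality)
      (rule embedding_least[OF assms], rule I.least_unique[OF _ embedding_least[OF assms]])
qed

lemma embedding_meet:
  assumes "a \<in> carrier L" "b \<in> carrier L"
  shows "f a \<sqinter>\<^bsub>inclusion_order (f ` carrier L)\<^esub> f b = f (a \<sqinter> b)"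
proof -
  interpret I: partial_order "inclusion_order (f ` carrier L)"
    by (rule inclusion_order_partial_order)
  show ?thesis
    unfolding meet_def[of "inclusion_order _"] inf_def[of "inclusion_order _"]
    by (rule some_equality)
      (rule embedding_greatest[OF assms], rule I.greatest_unique[OF _ embedding_greatest[OF assms]])
qed

end

end

lemma finite_inter_closedI:
  assumes "\<And>A B. A \<in> M \<Longrightarrow> B \<in> M \<Longrightarrow> A \<inter> B \<in> M"
  shows "finite_inter_closed M"
proof -
  have "\<Inter>\<A> \<in> M" if "finite \<A>" "\<A> \<noteq> {}" "\<A> \<subseteq> M" for \<A>
    using that by (induction \<A> rule: finite_ne_induct) (auto intro: assms)
  then show ?thesis by (simp add: finite_inter_closed_def)
qed

section \<open>The Stone representation\<close>

theorem theorem3p7: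
  fixes L :: "('a, 'b) gorder_scheme"
  assumes "lattice L"
  shows "order_isomorphism L (inclusion_order (stone_map L ` carrier L)) (stone_map L)
    \<and> lattice_of_sets (stone_map L ` carrier L)
    \<and> finite_inter_closed (stone_map L ` carrier L)
    \<and> separates (stone_map L ` carrier L) (semi_prime_filters L)
    \<and> (\<forall>a\<in>carrier L. \<forall>b\<in>carrier L.
          stone_map L a \<sqinter>\<^bsub>inclusion_order (stone_map L ` carrier L)\<^esub> stone_map L b
            = stone_map L (a \<sqinter>\<^bsub>L\<^esub> b)
        \<and> stone_map L (a \<sqinter>\<^bsub>L\<^esub> b) = stone_map L a \<inter> stone_map L b
        \<and> stone_map L a \<squnion>\<^bsub>inclusion_order (stone_map L ` carrier L)\<^esub> stone_map L b
            = stone_map L (a \<squnion>\<^bsub>L\<^esub> b)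
        \<and> stone_map L (a \<squnion>\<^bsub>L\<^esub> b) = (\<Union>x\<in>internals_bar L a b. stone_map L x))"
proof -
  interpret lattice L by (rule assms)
  note emb = stone_map_subset_iff
  have "finite_inter_closed (stone_map L ` carrier L)"
    by (rule finite_inter_closedI) (auto simp flip: stone_map_meet)
  then show ?thesis
    by (intro conjI ballI embedding_isomorphism[OF emb] embedding_lattice_of_sets[OF emb]
        stone_map_separates embedding_meet[OF emb] embedding_join[OF emb]
        stone_map_meet stone_map_join)
qed

end
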